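(* Let $X=\{x_0,x_1,x_{i_1},x_{i_2},\ldots,x_{i_j}\}$, where $j\ge1$ and $1<i_1<\cdots<i_j$, regarded as a generating set for Thompson's group $F$. Then $F$ is not minimally almost convex with respect to $X$.
   Context: Thompson's group $F$ is the group with presentation $\langle x_k,\ k\ge 0 \mid x_i^{-1}x_jx_i=x_{j+1}\ \text{if } i<j\rangle$; $\{x_k : k\ge 0\}$ is its standard infinite generating set. For a group $G$ with finite generating set $X$, $\Gamma(G,X)$ denotes the Cayley graph with vertex set $G$ and edges joining $g$ to $gx$ for $x\in X^{\pm1}$; all edges have length 1, and $d_X(g,h)$ (the least $n$ such that $g^{-1}h$ is a product of $n$ elements of $X^{\pm1}$) is the resulting word metric. $B(m)$ denotes the ball of radius $m$ centered at the identity; paths are edge paths in $\Gamma(G,X)$. Minimally almost convex: $G$ is minimally almost convex with respect to $X$ if, for all sufficiently large $m$, any two elements of $B(m)$ at distance $2$ can be joined by a path of length at most $2m-1$ lying in $B(m)$. *)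

theory Defs
  imports "HOL-Algebra.Generated_Groups" "Graph_Theory.Arc_Walk"
begin

section \<open>Groups given by presentations\<close>

text \<open>The letter \<open>(a, True)\<close> stands for the generator \<open>a\<close>, and
  \<open>(a, False)\<close> for its formal inverse.\<close>

type_synonym 'a word = "('a \<times> bool) list"

inductive pres_eq :: "('a word \<times> 'a word) set \<Rightarrow> 'a word \<Rightarrow> 'a word \<Rightarrow> bool"
  for R where
  refl: "pres_eq R w w"
| sym: "pres_eq R u v \<Longrightarrow> pres_eq R v u"
| trans: "pres_eq R u v \<Longrightarrow> pres_eq R v w \<Longrightarrow> pres_eq R u w"
| append: "pres_eq R u u' \<Longrightarrow> pres_eq R v v' \<Longrightarrow> pres_eq R (u @ v) (u' @ v')"
| cancel: "pres_eq R [(a, b), (a, \<not> b)] []"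
| rel: "(u, v) \<in> R \<Longrightarrow> pres_eq R u v"

definition word_class :: "('a word \<times> 'a word) set \<Rightarrow> 'a word \<Rightarrow> 'a word set" where
  "word_class R w = {v. pres_eq R w v}"

text \<open>The group generated by all elements of the type \<open>'a\<close> subject to the
  equations \<open>u = v\<close> for \<open>(u, v) \<in> R\<close>.\<close>

definition presented_group :: "('a word \<times> 'a word) set \<Rightarrow> 'a word set monoid" where
  "presented_group R =
    \<lparr>carrier = range (word_class R),
     mult = (\<lambda>A B. \<Union>u\<in>A. \<Union>v\<in>B. word_class R (u @ v)),
     one = word_class R []\<rparr>"

lemma word_class_eq_iff: "word_class R u = word_class R v \<longleftrightarrow> pres_eq R u v"
proof
  assume "word_class R u = word_class R v"
  then have "v \<in> word_class R u" by (simp add: word_class_def pres_eq.refl)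
  then show "pres_eq R u v" by (simp add: word_class_def)
next
  assume uv: "pres_eq R u v"
  have "pres_eq R u w \<longleftrightarrow> pres_eq R v w" for w
    using pres_eq.trans[OF uv, of w] pres_eq.trans[OF pres_eq.sym[OF uv], of w] by blast
  then show "word_class R u = word_class R v" by (simp add: word_class_def)
qed

lemma mem_word_class: "v \<in> word_class R u \<longleftrightarrow> word_class R v = word_class R u"
  unfolding word_class_eq_iff unfolding word_class_def by (blast intro: pres_eq.sym)

lemma presented_group_mult:
  "word_class R u \<otimes>\<^bsub>presented_group R\<^esub> word_class R v = word_class R (u @ v)"
proof -
  have *: "word_class R (u' @ v') = word_class R (u @ v)"
    if "u' \<in> word_class R u" "v' \<in> word_class R v" for u' v'
    using that unfolding mem_word_class word_class_eq_iff by (rule pres_eq.append)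
  have "u \<in> word_class R u" "v \<in> word_class R v"
    by (simp_all add: mem_word_class)
  then have "(\<Union>u'\<in>word_class R u. \<Union>v'\<in>word_class R v. word_class R (u' @ v')) = word_class R (u @ v)"
    using * by blast
  then show ?thesis by (simp add: presented_group_def)
qed

lemma word_class_inverse:
  "word_class R (rev (map (\<lambda>(a, b). (a, \<not> b)) w) @ w) = word_class R []"
proof (induction w)
  case (Cons l w)
  obtain a b where l: "l = (a, b)" by force
  let ?r = "rev (map (\<lambda>(a, b). (a, \<not> b)) w)"
  have "pres_eq R [(a, \<not> b), (a, b)] []"
    using pres_eq.cancel[of R a "\<not> b"] by simp
  then have "pres_eq R (?r @ [(a, \<not> b), (a, b)] @ w) (?r @ [] @ w)"
    by (rule pres_eq.append[OF pres_eq.refl pres_eq.append[OF _ pres_eq.refl]])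
  also have "pres_eq R (?r @ [] @ w) []" using Cons by (simp add: word_class_eq_iff)
  finally (pres_eq.trans) have "pres_eq R (?r @ [(a, \<not> b), (a, b)] @ w) []" .
  then show ?case unfolding word_class_eq_iff l by simp
qed simp

lemma group_presented_group: "group (presented_group R)"
proof (rule groupI)
  show "\<exists>y\<in>carrier (presented_group R).
          y \<otimes>\<^bsub>presented_group R\<^esub> x = \<one>\<^bsub>presented_group R\<^esub>"
    if x: "x \<in> carrier (presented_group R)" for x
  proof -
    obtain w where w: "x = word_class R w" using x by (auto simp: presented_group_def)
    have "word_class R (rev (map (\<lambda>(a, b). (a, \<not> b)) w)) \<otimes>\<^bsub>presented_group R\<^esub> x
        = \<one>\<^bsub>presented_group R\<^esub>"
      unfolding w presented_group_mult word_class_inverse by (simp add: presented_group_def)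
    moreover have "word_class R v \<in> carrier (presented_group R)" for v
      by (simp add: presented_group_def)
    ultimately show ?thesis by blast
  qed
next
  fix x y assume "x \<in> carrier (presented_group R)" "y \<in> carrier (presented_group R)"
  then obtain u v where "x = word_class R u" "y = word_class R v"
    by (auto simp: presented_group_def)
  then show "x \<otimes>\<^bsub>presented_group R\<^esub> y \<in> carrier (presented_group R)"
    by (simp add: presented_group_mult) (simp add: presented_group_def)
next
  fix x y z
  assume "x \<in> carrier (presented_group R)" "y \<in> carrier (presented_group R)"
    "z \<in> carrier (presented_group R)"
  then obtain u v w where "x = word_class R u" "y = word_class R v" "z = word_class R w"
    by (auto simp: presented_group_def)
  then show "x \<otimes>\<^bsub>presented_group R\<^esub> y \<otimes>\<^bsub>presented_group R\<^esub> z
    = x \<otimes>\<^bsub>presented_group R\<^esub> (y \<otimes>\<^bsub>presented_group R\<^esub> z)"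
    by (simp add: presented_group_mult)
next
  fix x assume "x \<in> carrier (presented_group R)"
  then obtain u where "x = word_class R u" by (auto simp: presented_group_def)
  moreover have "\<one>\<^bsub>presented_group R\<^esub> = word_class R []" by (simp add: presented_group_def)
  ultimately show "\<one>\<^bsub>presented_group R\<^esub> \<otimes>\<^bsub>presented_group R\<^esub> x = x"
    by (simp add: presented_group_mult)
qed (simp add: presented_group_def)

section \<open>Thompson's group\<close>

definition thompson_relations :: "(nat word \<times> nat word) set" where
  "thompson_relations =
    {([(i, False), (j, True), (i, True)], [(Suc j, True)]) | i j. i < j}"

definition thompson_F :: "nat word set monoid" where
  "thompson_F = presented_group thompson_relations"

definition thompson_gen :: "nat \<Rightarrow> nat word set" where
  "thompson_gen k = word_class thompson_relations [(k, True)]"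

section \<open>Cayley graphs and the word metric\<close>

definition symmetrized :: "('a, 'b) monoid_scheme \<Rightarrow> 'a set \<Rightarrow> 'a set" where
  "symmetrized G X = X \<union> m_inv G ` X"

text \<open>Each undirected edge is represented by its two orientations: the arc \<open>(g, s)\<close> runs
  from \<open>g\<close> to \<open>g s\<close>, and \<open>(g s, s\<^sup>-\<^sup>1)\<close> is its reverse.\<close>

definition cayley_graph :: "('a, 'b) monoid_scheme \<Rightarrow> 'a set \<Rightarrow> ('a, 'a \<times> 'a) pre_digraph" where
  "cayley_graph G X =
    \<lparr>verts = carrier G, arcs = carrier G \<times> symmetrized G X,
     tail = fst, head = (\<lambda>(g, s). g \<otimes>\<^bsub>G\<^esub> s)\<rparr>"

text \<open>Meaningful only if \<open>X\<close> generates \<open>G\<close>: otherwise the set of which the least element is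
  taken may be empty.\<close>

definition word_dist :: "('a, 'b) monoid_scheme \<Rightarrow> 'a set \<Rightarrow> 'a \<Rightarrow> 'a \<Rightarrow> nat" where
  "word_dist G X g h =
    (LEAST n. \<exists>ss. length ss = n \<and> set ss \<subseteq> symmetrized G X \<and>
       inv\<^bsub>G\<^esub> g \<otimes>\<^bsub>G\<^esub> h = foldr (mult G) ss \<one>\<^bsub>G\<^esub>)"

definition word_ball :: "('a, 'b) monoid_scheme \<Rightarrow> 'a set \<Rightarrow> nat \<Rightarrow> 'a set" where
  "word_ball G X m = {g \<in> carrier G. word_dist G X \<one>\<^bsub>G\<^esub> g \<le> m}"

text \<open>An edge path lies in the ball if all its vertices do.\<close>

definition minimally_almost_convex :: "('a, 'b) monoid_scheme \<Rightarrow> 'a set \<Rightarrow> bool" where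
  "minimally_almost_convex G X \<longleftrightarrow>
    (\<exists>M. \<forall>m\<ge>M. \<forall>g\<in>word_ball G X m. \<forall>h\<in>word_ball G X m. word_dist G X g h = 2 \<longrightarrow>
      (\<exists>p. pre_digraph.awalk (cayley_graph G X) g p h \<and>
           set (pre_digraph.awalk_verts (cayley_graph G X) g p) \<subseteq> word_ball G X m \<and>
           length p \<le> 2 * m - 1))"

section \<open>Basic facts on Thompson's group\<close>

lemma group_thompson_F: "group thompson_F"
  unfolding thompson_F_def by (rule group_presented_group)

lemma thompson_gen_closed: "thompson_gen k \<in> carrier thompson_F"
  by (auto simp: thompson_F_def thompson_gen_def presented_group_def)

lemma thompson_F_inv_gen:
  "inv\<^bsub>thompson_F\<^esub> thompson_gen k = word_class thompson_relations [(k, False)]"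
proof -
  interpret group thompson_F by (rule group_thompson_F)
  have "word_class thompson_relations [(k, False)] \<otimes>\<^bsub>thompson_F\<^esub> thompson_gen k = \<one>\<^bsub>thompson_F\<^esub>"
    using pres_eq.cancel[of thompson_relations k False]
    unfolding thompson_F_def thompson_gen_def presented_group_mult
    by (simp add: presented_group_def word_class_eq_iff)
  moreover have "word_class thompson_relations [(k, False)] \<in> carrier thompson_F"
    by (simp add: thompson_F_def presented_group_def)
  ultimately show ?thesis by (metis inv_equality thompson_gen_closed)
qed

lemma thompson_F_relation:
  assumes "i < j"
  shows "inv\<^bsub>thompson_F\<^esub> thompson_gen i \<otimes>\<^bsub>thompson_F\<^esub> thompson_gen j \<otimes>\<^bsub>thompson_F\<^esub> thompson_gen i
    = thompson_gen (Suc j)"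
  using assms pres_eq.rel[of "[(i, False), (j, True), (i, True)]" "[(Suc j, True)]"
    thompson_relations]
  unfolding thompson_F_inv_gen
  unfolding thompson_gen_def thompson_F_def presented_group_mult
  by (auto simp: word_class_eq_iff thompson_relations_def)

lemma generate_thompson_F:
  assumes "{thompson_gen 0, thompson_gen 1} \<subseteq> X" "X \<subseteq> carrier thompson_F"
  shows "generate thompson_F X = carrier thompson_F"
proof -
  interpret group thompson_F by (rule group_thompson_F)
  have gen: "thompson_gen k \<in> generate thompson_F X" for k
  proof (induction k)
    case (Suc k)
    show ?case
    proof (cases "k = 0")
      case True
      then show ?thesis using assms by (auto intro: generate.incl)
    next
      case False
      have 0: "thompson_gen 0 \<in> X" using assms by simp
      have "inv\<^bsub>thompson_F\<^esub> thompson_gen 0 \<otimes>\<^bsub>thompson_F\<^esub> thompson_gen k \<otimes>\<^bsub>thompson_F\<^esub> thompson_gen 0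
        \<in> generate thompson_F X"
        by (intro generate.eng generate.inv[OF 0] generate.incl[OF 0] Suc)
      then show ?thesis using False thompson_F_relation[of 0 k] by simp
    qed
  qed (use assms in \<open>auto intro: generate.incl\<close>)
  have "word_class thompson_relations w \<in> generate thompson_F X" for w
  proof (induction w)
    case Nil
    then show ?case
      using generate.one[of thompson_F X] by (simp add: thompson_F_def presented_group_def)
  next
    case (Cons l w)
    obtain a b where l: "l = (a, b)" by force
    have "word_class thompson_relations [(a, False)] \<in> generate thompson_F X"
      using generate_m_inv_closed[OF assms(2) gen[of a]] by (simp add: thompson_F_inv_gen)
    then have "word_class thompson_relations [l] \<in> generate thompson_F X"
      using gen[of a] unfolding l by (cases b) (simp_all add: thompson_gen_def)
    then have "word_class thompson_relations [l] \<otimes>\<^bsub>thompson_F\<^esub> word_class thompson_relations w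
      \<in> generate thompson_F X"
      using Cons by (rule generate.eng)
    then show ?case by (simp add: thompson_F_def presented_group_mult)
  qed
  then show ?thesis
    using generate_incl[OF assms(2)] by (auto simp: thompson_F_def presented_group_def)
qed

end

theory Submission
  imports Defs Complex_Main
begin

text \<open>
  Let \<open>n\<close> be the largest index of a generator in \<open>X\<close>. For every \<open>k \<ge> 2\<close> put \<open>m = 2 k\<close> and consider
  \<open>r = x\<^sub>0\<^sup>k x\<^sub>1\<^sup>-\<^sup>1 x\<^sub>0\<^sup>-\<^sup>(\<^sup>k\<^sup>-\<^sup>1\<^sup>)\<close> and \<open>l = r x\<^sub>n x\<^sub>0\<close>. Sliding \<open>x\<^sub>n\<close> to the front of \<open>l\<close> cancels one
  \<open>x\<^sub>0\<^sup>-\<^sup>1\<close> against the final \<open>x\<^sub>0\<close> (\<open>short_word_for_neighbour\<close>), so both \<open>r\<close> and \<open>l\<close> lie in \<open>B(m)\<close>; they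
  are at distance \<open>2\<close>. Every path in \<open>B(m)\<close> from \<open>r\<close> to \<open>l\<close> has length at least \<open>2 m\<close>.

  To see this, let \<open>F\<close> act on the real line from the right, \<open>x\<^sub>0\<close> being the translation by \<open>1\<close> and
  \<open>x\<^sub>i\<close>, for \<open>i \<ge> 1\<close>, the map that fixes everything up to \<open>i - 1\<close>, doubles the interval \<open>[i - 1, i]\<close>
  and translates by \<open>1\<close> after it. Let \<open>a(g)\<close> be the exponent sum of \<open>x\<^sub>0\<close> in \<open>g\<close> and \<open>c(g)\<close> that of
  all other generators. Then \<open>g\<close> is the translation by \<open>a(g)\<close> near \<open>-\<infinity>\<close> and the translation by
  \<open>a(g) + c(g)\<close> near \<open>+\<infinity>\<close>. Two marks record deviations from these: \<open>g\<close> has the left mark if it moves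
  the point \<open>1 - k\<close> by less than \<open>a(g)\<close>, and the right mark if it moves the point \<open>n - 1\<close> by less
  than \<open>a(g) + c(g)\<close>. The identity has no mark, \<open>r\<close> has only the left one, \<open>l\<close> has both.

  A generator \<open>x\<^sub>i\<close> with \<open>i \<ge> 1\<close> can change the left mark only if it does not fix the image of the
  marked point, and the right mark only if it does not translate it by \<open>1\<close>; \<open>x\<^sub>0\<close> changes neither.
  Hence the left mark is changed only at elements with \<open>a \<ge> k\<close>, the right mark is gained
  only by an edge \<open>g \<rightarrow> g x\<^sub>i\<close> with \<open>a(g) + c(g) \<le> i - n \<le> 0\<close>, and the sign of the letter that
  makes the change is determined as well (\<open>left_mark_lost\<close>, \<open>left_mark_gained\<close>,
  \<open>right_mark_gained\<close>). Counting letters in the plane with coordinates \<open>(a, c)\<close> does the rest.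
  An element with both marks and \<open>a + c \<le> 1\<close> has length greater than \<open>2 k\<close>
  (\<open>both_marks_length\<close>). So a path in \<open>B(m)\<close> must be without the left mark when it gains the right
  one: it loses the left mark first, comes back to \<open>a + c \<le> 0\<close>, and has to regain the left
  mark afterwards. Each of these two excursions to \<open>a \<ge> k\<close> takes at least \<open>2 k\<close> steps
  (\<open>path_through_small_ball_is_long\<close>), and \<open>4 k = 2 m\<close>.
\<close>

section \<open>The action on the real line and two exponent sums\<close>

text \<open>The usual piecewise linear action, normalized so that \<open>x\<^sub>0\<close> is a translation: it shifts the
  support \<open>[i - 1, \<infinity>)\<close> of \<open>x\<^sub>i\<close>, for \<open>i \<ge> 1\<close>, to that of \<open>x\<^sub>i\<^sub>+\<^sub>1\<close>.\<close>

definition gen_map :: "nat \<Rightarrow> real \<Rightarrow> real" where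
  "gen_map i t =
    (if i = 0 then t + 1
     else if t \<le> real i - 1 then t
     else if t \<le> real i then 2 * t - (real i - 1)
     else t + 1)"

definition gen_map_inv :: "nat \<Rightarrow> real \<Rightarrow> real" where
  "gen_map_inv i t =
    (if i = 0 then t - 1
     else if t \<le> real i - 1 then t
     else if t \<le> real i + 1 then (t + (real i - 1)) / 2
     else t - 1)"

fun letter_map :: "nat \<times> bool \<Rightarrow> real \<Rightarrow> real" where
  "letter_map (i, b) = (if b then gen_map i else gen_map_inv i)"

text \<open>The leftmost letter acts first, so that appending a letter to a word, which is a step in the
  Cayley graph, composes with the letter on the outside.\<close>

definition word_map :: "nat word \<Rightarrow> real \<Rightarrow> real" where
  "word_map w t = fold letter_map w t"

text \<open>Only \<open>x\<^sub>0\<close> acts nontrivially near \<open>-\<infinity>\<close>, so its exponent sum is the translation length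
  there; adding the exponent sum of the other generators gives the translation length near
  \<open>+\<infinity>\<close>. In terms of forest diagrams, \<open>x\<^sub>0\<close> shifts the pointer and every other generator acts by one
  caret, hence the names.\<close>

fun shift_letter :: "nat \<times> bool \<Rightarrow> int" where
  "shift_letter (i, b) = (if i = 0 then if b then 1 else -1 else 0)"

fun caret_letter :: "nat \<times> bool \<Rightarrow> int" where
  "caret_letter (i, b) = (if i = 0 then 0 else if b then 1 else -1)"

definition shift_sum :: "nat word \<Rightarrow> int" where
  "shift_sum w = (\<Sum>x\<leftarrow>w. shift_letter x)"

definition caret_sum :: "nat word \<Rightarrow> int" where
  "caret_sum w = (\<Sum>x\<leftarrow>w. caret_letter x)"

lemma word_map_simps [simp]:
  "word_map [] t = t"
  "word_map (x # w) t = word_map w (letter_map x t)"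
  "word_map (u @ w) t = word_map w (word_map u t)"
  by (simp_all add: word_map_def)

lemma sums_simps [simp]:
  "shift_sum [] = 0" "shift_sum (x # w) = shift_letter x + shift_sum w"
  "shift_sum (u @ w) = shift_sum u + shift_sum w"
  "caret_sum [] = 0" "caret_sum (x # w) = caret_letter x + caret_sum w"
  "caret_sum (u @ w) = caret_sum u + caret_sum w"
  by (simp_all add: shift_sum_def caret_sum_def)

lemma gen_map_inverse: "gen_map_inv i (gen_map i t) = t" "gen_map i (gen_map_inv i t) = t"
  by (auto simp: gen_map_def gen_map_inv_def field_simps)

text \<open>Where the inverse of \<open>x\<^sub>i\<close> lands in the part fixed by \<open>x\<^sub>j\<close>, the conjugate is the identity,
  as is \<open>x\<^sub>j\<^sub>+\<^sub>1\<close>. Otherwise both \<open>x\<^sub>i\<close> and its inverse only translate the points involved, because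
  \<open>j - 1 \<ge> i\<close>.\<close>

lemma gen_map_relation:
  assumes "i < j"
  shows "gen_map i (gen_map j (gen_map_inv i t)) = gen_map (Suc j) t"
proof (cases "gen_map_inv i t \<le> real j - 1")
  case True
  have "real i + 1 \<le> real j" using assms by linarith
  then have "t \<le> real j"
    using True by (auto simp: gen_map_inv_def split: if_splits)
  moreover have "gen_map j (gen_map_inv i t) = gen_map_inv i t"
    using True assms by (simp add: gen_map_def)
  ultimately show ?thesis
    using gen_map_inverse(2)[of i t] by (simp add: gen_map_def)
next
  case False
  have ij: "real i + 1 \<le> real j" using assms by linarith
  have inv: "gen_map_inv i t = t - 1"
    using False ij by (simp add: gen_map_inv_def split: if_splits)
  have shifted: "gen_map j (t - 1) = gen_map (Suc j) t - 1"
    using assms by (simp add: gen_map_def)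
  have "gen_map j (t - 1) > real i"
    using False ij inv assms by (simp add: gen_map_def)
  then have "gen_map i (gen_map j (t - 1)) = gen_map j (t - 1) + 1"
    unfolding gen_map_def[of i] by simp
  then show ?thesis by (simp add: inv shifted)
qed

lemma pres_eq_invariants:
  assumes "pres_eq thompson_relations u v"
  shows "word_map u = word_map v" and "shift_sum u = shift_sum v" and "caret_sum u = caret_sum v"
proof -
  have "word_map u = word_map v \<and> shift_sum u = shift_sum v \<and> caret_sum u = caret_sum v"
    using assms
  proof (induction)
    case (append u u' v v')
    then show ?case by (simp add: fun_eq_iff)
  next
    case (cancel a b)
    then show ?case by (simp add: fun_eq_iff gen_map_inverse)
  next
    case (rel u v)
    then obtain i j where "u = [(i, False), (j, True), (i, True)]" "v = [(Suc j, True)]" "i < j"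
      by (auto simp: thompson_relations_def)
    then show ?case by (simp add: fun_eq_iff gen_map_relation)
  qed metis+
  then show "word_map u = word_map v" "shift_sum u = shift_sum v" "caret_sum u = caret_sum v"
    by blast+
qed

section \<open>Marks at the two ends\<close>

text \<open>The point \<open>1 - k\<close> is chosen so that it must first be moved by \<open>k\<close>, to the end \<open>1\<close> of the
  interval doubled by \<open>x\<^sub>1\<close>, before a generator other than \<open>x\<^sub>0\<close> can move it. The point \<open>n - 1\<close>
  is the largest one that \<open>x\<^sub>n\<close> fixes, so \<open>x\<^sub>n\<close> itself has the right mark.\<close>

definition left_mark :: "nat \<Rightarrow> nat word \<Rightarrow> bool" where
  "left_mark k w \<longleftrightarrow> word_map w (1 - real k) < 1 - real k + shift_sum w"

definition right_mark :: "nat \<Rightarrow> nat word \<Rightarrow> bool" where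
  "right_mark n w \<longleftrightarrow> word_map w (real n - 1) < real n - 1 + (shift_sum w + caret_sum w)"

lemma marks_cong:
  assumes "pres_eq thompson_relations u v"
  shows "left_mark k u = left_mark k v" "right_mark n u = right_mark n v"
  by (simp_all add: left_mark_def right_mark_def pres_eq_invariants[OF assms])

lemma no_marks_Nil [simp]: "\<not> left_mark k []" "\<not> right_mark n []"
  by (simp_all add: left_mark_def right_mark_def)

text \<open>Let \<open>q < 1 - k + a\<close> be the image of \<open>1 - k\<close>. To lose the mark, \<open>q\<close> has to move to the right
  relative to \<open>a\<close>; this needs some \<open>x\<^sub>i\<close> with \<open>q\<close> beyond its fixed part, that is, \<open>i - 1 < q\<close>.\<close>

lemma left_mark_lost:
  assumes "left_mark k u" "\<not> left_mark k (u @ [(i, b)])"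
  shows "i \<noteq> 0" "b" "shift_sum u \<ge> int k + int i - 1"
proof -
  let ?q = "word_map u (1 - real k)"
  have q: "?q < 1 - real k + shift_sum u" using assms(1) by (simp add: left_mark_def)
  have q': "letter_map (i, b) ?q \<ge> 1 - real k + (shift_sum u + shift_letter (i, b))"
    using assms(2) by (simp add: left_mark_def)
  show i: "i \<noteq> 0"
    using q q' by (cases b) (auto simp: gen_map_def gen_map_inv_def split: if_splits)
  show b: "b"
    using q q' i by (cases b) (auto simp: gen_map_inv_def field_simps split: if_splits)
  have "?q > real i - 1"
    using q q' i b by (auto simp: gen_map_def split: if_splits)
  then have "real_of_int (int i - 1) < real_of_int (1 - int k + shift_sum u)" using q by simp
  then show "shift_sum u \<ge> int k + int i - 1" unfolding of_int_less_iff by simp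
qed

text \<open>Undoing the letter loses the mark again, and \<open>i \<ge> 1\<close> turns \<open>a \<ge> k + i - 1\<close> into \<open>a \<ge> k\<close>.\<close>

lemma left_mark_gained:
  assumes "\<not> left_mark k u" "left_mark k (u @ [(i, b)])"
  shows "i \<noteq> 0" "\<not> b" "shift_sum u \<ge> int k"
proof -
  have "pres_eq thompson_relations (u @ [(i, b), (i, \<not> b)]) (u @ [])"
    by (intro pres_eq.append pres_eq.refl pres_eq.cancel)
  then have "\<not> left_mark k ((u @ [(i, b)]) @ [(i, \<not> b)])"
    using assms(1) by (simp add: marks_cong)
  from left_mark_lost[OF assms(2) this]
  show "i \<noteq> 0" "\<not> b" "shift_sum u \<ge> int k" by auto
qed

text \<open>Let \<open>q \<ge> n - 1 + a + c\<close> be the image of \<open>n - 1\<close>. To gain the mark, \<open>q\<close> must not keep up with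
  the growth of \<open>a + c\<close>; this needs some \<open>x\<^sub>i\<close> with \<open>q\<close> before its translation part, that is,
  \<open>q < i\<close>.\<close>

lemma right_mark_gained:
  assumes "\<not> right_mark n u" "right_mark n (u @ [(i, b)])"
  shows "i \<noteq> 0" "b" "shift_sum u + caret_sum u \<le> int i - int n"
proof -
  let ?q = "word_map u (real n - 1)"
  let ?s = "shift_sum u + caret_sum u"
  have q: "?q \<ge> real n - 1 + ?s" using assms(1) by (simp add: right_mark_def)
  have q': "letter_map (i, b) ?q < real n - 1 + (?s + shift_letter (i, b) + caret_letter (i, b))"
    using assms(2) by (simp add: right_mark_def algebra_simps)
  show i: "i \<noteq> 0"
    using q q' by (cases b) (auto simp: gen_map_def gen_map_inv_def split: if_splits)
  show b: "b"
    using q q' i by (cases b) (auto simp: gen_map_inv_def field_simps split: if_splits)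
  have "?q < real i"
    using q q' i b by (auto simp: gen_map_def split: if_splits)
  then have "real_of_int (int n - 1 + ?s) < real_of_int (int i)" using q by simp
  then show "?s \<le> int i - int n" unfolding of_int_less_iff by simp
qed

section \<open>Counting letters\<close>

definition shifts :: "nat word \<Rightarrow> nat" where
  "shifts w = length (filter (\<lambda>(i, b). i = 0) w)"

definition ups :: "nat word \<Rightarrow> nat" where
  "ups w = length (filter (\<lambda>(i, b). i \<noteq> 0 \<and> b) w)"

definition downs :: "nat word \<Rightarrow> nat" where
  "downs w = length (filter (\<lambda>(i, b). i \<noteq> 0 \<and> \<not> b) w)"

lemma length_eq_counts: "length w = shifts w + ups w + downs w"
  by (induction w) (auto simp: shifts_def ups_def downs_def)

lemma caret_sum_eq_counts: "caret_sum w = int (ups w) - int (downs w)"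
  by (induction w) (auto simp: ups_def downs_def split: if_splits)

lemma abs_shift_sum_le: "\<bar>shift_sum w\<bar> \<le> int (shifts w)"
  by (induction w) (auto simp: shifts_def)

lemma length_ge_sums: "\<bar>shift_sum w\<bar> + \<bar>caret_sum w\<bar> \<le> int (length w)"
  using abs_shift_sum_le[of w] caret_sum_eq_counts[of w] length_eq_counts[of w] by linarith

text \<open>A walk on the integers that starts and ends below \<open>h\<close> and visits \<open>h\<close> pays for both
  ways.\<close>

lemma shifts_ge_excursion:
  assumes "shift_sum (u @ p) \<ge> h"
  shows "int (shifts (p @ q)) \<ge> 2 * h - shift_sum u - shift_sum (u @ p @ q)"
  using abs_shift_sum_le[of p] abs_shift_sum_le[of q] assms by (simp add: shifts_def)

lemma switching_letter:
  assumes "P u" "\<not> P (u @ w)"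
  shows "\<exists>p i b q. w = p @ (i, b) # q \<and> P (u @ p) \<and> \<not> P ((u @ p) @ [(i, b)])"
  using assms
proof (induction w rule: rev_induct)
  case (snoc y w)
  obtain i b where y: "y = (i, b)" by (cases y)
  show ?case
  proof (cases "P (u @ w)")
    case True
    then have "w @ [y] = w @ (i, b) # [] \<and> P (u @ w) \<and> \<not> P ((u @ w) @ [(i, b)])"
      using snoc.prems(2) y by simp
    then show ?thesis by blast
  next
    case False
    with snoc.IH snoc.prems(1) obtain p i b q
      where *: "w = p @ (i, b) # q" "P (u @ p)" "\<not> P ((u @ p) @ [(i, b)])"
      by auto
    from this(1) have "w @ [y] = p @ (i, b) # (q @ [y])" by simp
    with *(2,3) show ?thesis by blast
  qed
qed simp

text \<open>Changing the left mark costs an excursion to \<open>a \<ge> k\<close> and a letter of a definite sign. Since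
  \<open>c\<close> is the number of letters \<open>x\<^sub>i\<close> minus that of their inverses (\<open>i \<ge> 1\<close>), one forced letter
  against the drift of \<open>c\<close> adds two to the length.\<close>

lemma left_mark_lost_count:
  assumes "left_mark k u" "\<not> left_mark k (u @ w)"
  shows "int (shifts w) \<ge> 2 * int k - shift_sum u - shift_sum (u @ w)" and "ups w \<ge> 1"
proof -
  obtain p i b q where w: "w = p @ (i, b) # q"
    and *: "left_mark k (u @ p)" "\<not> left_mark k ((u @ p) @ [(i, b)])"
    using switching_letter[of "left_mark k", OF assms] by (elim exE conjE) (rule that)
  note lost = left_mark_lost[OF *]
  show "int (shifts w) \<ge> 2 * int k - shift_sum u - shift_sum (u @ w)"
    unfolding w using shifts_ge_excursion[of "int k" u p "(i, b) # q"] lost(1,3) by simp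
  show "ups w \<ge> 1" unfolding w using lost(1,2) by (simp add: ups_def)
qed

lemma left_mark_gained_count:
  assumes "\<not> left_mark k u" "left_mark k (u @ w)"
  shows "int (shifts w) \<ge> 2 * int k - shift_sum u - shift_sum (u @ w)" and "downs w \<ge> 1"
proof -
  obtain p i b q where w: "w = p @ (i, b) # q"
    and *: "\<not> left_mark k (u @ p)" "left_mark k ((u @ p) @ [(i, b)])"
    using switching_letter[of "\<lambda>v. \<not> left_mark k v" u w] assms by blast
  note gained = left_mark_gained[OF *]
  show "int (shifts w) \<ge> 2 * int k - shift_sum u - shift_sum (u @ w)"
    unfolding w using shifts_ge_excursion[of "int k" u p "(i, b) # q"] gained(3) by simp
  show "downs w \<ge> 1" unfolding w using gained(1,2) by (simp add: downs_def)
qed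

lemma right_mark_ups:
  assumes "right_mark n w"
  shows "ups w \<ge> 1"
proof -
  obtain p i b q where w: "w = p @ (i, b) # q"
    and *: "\<not> right_mark n p" "right_mark n (p @ [(i, b)])"
    using switching_letter[of "\<lambda>v. \<not> right_mark n v" "[]" w] assms by auto
  show ?thesis unfolding w using right_mark_gained[OF *] by (simp add: ups_def)
qed

text \<open>The excursion to \<open>a \<ge> k\<close> takes at least \<open>2 k - a\<close> letters \<open>x\<^sub>0\<^sup>\<plusminus>\<^sup>1\<close>. Among the other letters
  at least one, which creates the right mark, is positive; as their exponent sum \<open>c\<close> is at most
  \<open>1 - a\<close>, there are at least \<open>2 - c \<ge> a + 1\<close> of them.\<close>

lemma both_marks_length:
  assumes "left_mark k w" "right_mark n w" "shift_sum w + caret_sum w \<le> 1"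
  shows "length w > 2 * k"
  using left_mark_gained_count(1)[of k "[]" w] right_mark_ups[OF assms(2)] assms(1,3)
    length_eq_counts[of w] caret_sum_eq_counts[of w] by simp

section \<open>Two elements at distance two\<close>

text \<open>This element is close to the inverse of the generator \<open>x\<^sub>1\<close> moved \<open>k\<close> units to the left; the
  missing last \<open>x\<^sub>0\<^sup>-\<^sup>1\<close> leaves it at \<open>a = 1\<close>, \<open>c = -1\<close>.\<close>

definition left_word :: "nat \<Rightarrow> nat word" where
  "left_word k = replicate k (0, True) @ [(1, False)] @ replicate (k - 1) (0, False)"

lemma word_map_replicate_shift [simp]:
  "word_map (replicate m (0, True)) t = t + real m"
  "word_map (replicate m (0, False)) t = t - real m"
  by (induction m arbitrary: t) (simp_all add: gen_map_def gen_map_inv_def)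

lemma sums_replicate_shift [simp]:
  "shift_sum (replicate m (0, b)) = (if b then int m else - int m)"
  "caret_sum (replicate m (0, b)) = 0"
  by (induction m) simp_all

lemma left_word_values:
  assumes "k \<ge> 2" "n \<ge> 2"
  shows "shift_sum (left_word k) = 1" "caret_sum (left_word k) = -1"
    "left_mark k (left_word k)" "\<not> right_mark n (left_word k)"
    "left_mark k (left_word k @ [(n, True), (0, True)])"
    "right_mark n (left_word k @ [(n, True), (0, True)])"
  using assms
  by (simp_all add: left_word_def left_mark_def right_mark_def gen_map_def gen_map_inv_def)

lemma thompson_swap:
  assumes "i < j"
  shows "pres_eq thompson_relations [(j, True), (i, True)] [(i, True), (Suc j, True)]"
proof -
  have "pres_eq thompson_relations ([(i, True), (i, False)] @ [(j, True), (i, True)]) [(j, True), (i, True)]"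
    using pres_eq.append[OF pres_eq.cancel[of _ i True] pres_eq.refl] by simp
  moreover have "pres_eq thompson_relations ([(i, True)] @ [(i, False), (j, True), (i, True)])
      ([(i, True)] @ [(Suc j, True)])"
    using assms by (intro pres_eq.append pres_eq.refl pres_eq.rel) (auto simp: thompson_relations_def)
  ultimately show ?thesis by (auto intro: pres_eq.trans pres_eq.sym)
qed

lemma thompson_swap_inv:
  assumes "i < j"
  shows "pres_eq thompson_relations [(Suc j, True), (i, False)] [(i, False), (j, True)]"
proof -
  have "pres_eq thompson_relations ([(i, False), (j, True), (i, True)] @ [(i, False)])
     ([(Suc j, True)] @ [(i, False)])"
    using assms by (intro pres_eq.append pres_eq.refl pres_eq.rel) (auto simp: thompson_relations_def)
  moreover have "pres_eq thompson_relations ([(i, False), (j, True)] @ [(i, True), (i, False)])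
     ([(i, False), (j, True)] @ [])"
    using pres_eq.cancel[of _ i True] by (intro pres_eq.append pres_eq.refl) simp
  ultimately show ?thesis by (auto intro: pres_eq.trans pres_eq.sym)
qed

lemma swap_shifts:
  assumes "0 < j"
  shows "pres_eq thompson_relations ((j, True) # replicate m (0, True)) (replicate m (0, True) @ [(j + m, True)])"
  using assms
proof (induction m arbitrary: j)
  case (Suc m)
  have "pres_eq thompson_relations ([(j, True), (0, True)] @ replicate m (0, True))
    ([(0, True), (Suc j, True)] @ replicate m (0, True))"
    using Suc.prems by (intro pres_eq.append pres_eq.refl thompson_swap)
  moreover have "pres_eq thompson_relations ([(0, True)] @ ((Suc j, True) # replicate m (0, True)))
    ([(0, True)] @ (replicate m (0, True) @ [(Suc j + m, True)]))"
    by (intro pres_eq.append pres_eq.refl Suc.IH) simp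
  ultimately show ?case by (auto intro: pres_eq.trans)
qed (simp add: pres_eq.refl)

lemma swap_inverse_shifts:
  assumes "0 < j"
  shows "pres_eq thompson_relations ((j + m, True) # replicate m (0, False)) (replicate m (0, False) @ [(j, True)])"
proof (induction m)
  case (Suc m)
  have "pres_eq thompson_relations ([(Suc (j + m), True), (0, False)] @ replicate m (0, False))
    ([(0, False), (j + m, True)] @ replicate m (0, False))"
    using assms by (intro pres_eq.append pres_eq.refl thompson_swap_inv) simp
  moreover have "pres_eq thompson_relations ([(0, False)] @ ((j + m, True) # replicate m (0, False)))
    ([(0, False)] @ (replicate m (0, False) @ [(j, True)]))"
    by (intro pres_eq.append pres_eq.refl Suc.IH)
  ultimately show ?case by (auto intro: pres_eq.trans)
qed (simp add: pres_eq.refl)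

text \<open>The letter \<open>x\<^sub>n\<close> is pulled to the front through the word: its index grows by one at each of
  the \<open>k - 1\<close> letters \<open>x\<^sub>0\<^sup>-\<^sup>1\<close> and at \<open>x\<^sub>1\<^sup>-\<^sup>1\<close>, and shrinks by one at each of the \<open>k\<close> letters \<open>x\<^sub>0\<close>, so
  that it arrives as \<open>x\<^sub>n\<close>.\<close>

lemma short_word_for_neighbour:
  assumes "k \<ge> 2" "n \<ge> 2"
  shows "pres_eq thompson_relations (left_word k @ [(n, True), (0, True)])
    ((n, True) # replicate k (0, True) @ (1, False) # replicate (k - 2) (0, False))"
proof -
  let ?e = "pres_eq thompson_relations"
  let ?x = "replicate k (0, True) :: nat word" and ?y = "replicate (k - 1) (0, False) :: nat word"
    and ?z = "replicate (k - 2) (0, False) :: nat word"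
  have z: "?y = ?z @ [(0, False)]"
    using assms by (cases "k - 1") (simp_all add: replicate_append_same numeral_2_eq_2)
  have "?e (((n, True) # ?x) @ (1, False) # ?z) ((?x @ [(n + k, True)]) @ (1, False) # ?z)"
    using assms by (intro pres_eq.append pres_eq.refl swap_shifts) simp
  moreover have "?e (?x @ ([(Suc (n + (k - 1)), True), (1, False)]) @ ?z)
      (?x @ [(1, False), (n + (k - 1), True)] @ ?z)"
    using assms by (intro pres_eq.append pres_eq.refl thompson_swap_inv) simp
  moreover have "?e ((?x @ (1, False) # [(n + (k - 1), True)] @ ?z) @ [(0, False), (0, True)])
     ((?x @ (1, False) # [(n + (k - 1), True)] @ ?z) @ [])"
    using pres_eq.cancel[of _ 0 False] by (intro pres_eq.append pres_eq.refl) simp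
  moreover have "?e ((?x @ [(1, False)]) @ ((n + (k - 1), True) # ?y) @ [(0, True)])
     ((?x @ [(1, False)]) @ (?y @ [(n, True)]) @ [(0, True)])"
    using assms by (intro pres_eq.append pres_eq.refl swap_inverse_shifts) simp
  moreover have "Suc (n + (k - 1)) = n + k" using assms by simp
  ultimately show ?thesis
    unfolding left_word_def z by simp (meson pres_eq.sym pres_eq.trans)
qed

text \<open>Here \<open>w\<close> spells a path from \<open>r\<close> to \<open>r x\<^sub>n x\<^sub>0\<close> inside the ball of radius \<open>2 k\<close>. It is cut at a
  letter that creates the right mark. The ball forbids the left mark on both sides of this letter,
  although both ends of the path carry it, so each of the two pieces changes the left mark.\<close>

lemma path_through_small_ball_is_long:
  assumes "k \<ge> 2" "n \<ge> 2"
    and index: "fst ` set w \<subseteq> {..n}"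
    and ball: "\<And>p q. w = p @ q \<Longrightarrow>
      \<exists>v. pres_eq thompson_relations (left_word k @ p) v \<and> length v \<le> 2 * k"
    and target: "pres_eq thompson_relations (left_word k @ w) (left_word k @ [(n, True), (0, True)])"
  shows "length w \<ge> 4 * k"
proof -
  let ?r = "left_word k"
  note vals = left_word_values[OF assms(1,2)]
  have end_marks: "left_mark k (?r @ w)" "right_mark n (?r @ w)"
    using vals(5,6) marks_cong[OF target] by blast+
  have end_sums: "shift_sum (?r @ w) = 2" "caret_sum (?r @ w) = 0"
    using pres_eq_invariants(2,3)[OF target] vals(1,2) assms(2) by auto
  obtain p i b q where w: "w = p @ (i, b) # q"
    and R: "\<not> right_mark n (?r @ p)" "right_mark n ((?r @ p) @ [(i, b)])"
    using switching_letter[of "\<lambda>v. \<not> right_mark n v" ?r w] vals(4) end_marks(2) by blast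
  note gained = right_mark_gained[OF R]
  have i: "1 \<le> i" "i \<le> n" and b: b using gained index w by auto
  have sum_le: "shift_sum (?r @ p) + caret_sum (?r @ p) \<le> int i - int n" by (rule gained(3))
  \<comment> \<open>With both marks, and with \<open>a + c \<le> 1\<close>, the path would be outside the ball.\<close>
  have after: "\<not> left_mark k ((?r @ p) @ [(i, b)])"
  proof
    assume L: "left_mark k ((?r @ p) @ [(i, b)])"
    obtain v where v: "pres_eq thompson_relations ((?r @ p) @ [(i, b)]) v" "length v \<le> 2 * k"
      using ball[of "p @ [(i, b)]" q] w by auto
    have "shift_sum v + caret_sum v \<le> 1"
      unfolding pres_eq_invariants(2,3)[OF v(1), symmetric] using sum_le i b by simp
    then show False
      using both_marks_length[of k v n] L R(2) v(2) marks_cong(1)[OF v(1), of k]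
        marks_cong(2)[OF v(1), of n] by linarith
  qed
  \<comment> \<open>Otherwise a single letter \<open>x\<^sub>i\<close> changes both marks, so \<open>a \<ge> k + i - 1\<close> and \<open>a + c \<le> i - n\<close>.
    The exponent sums alone then force length \<open>2 k + i + n - 2\<close>, which exceeds \<open>2 k\<close> exactly because
    \<open>n \<ge> 2\<close> and \<open>i \<ge> 1\<close>.\<close>
  have before: "\<not> left_mark k (?r @ p)"
  proof
    assume "left_mark k (?r @ p)"
    from left_mark_lost(3)[OF this after]
    have "shift_sum (?r @ p) \<ge> int k + int i - 1" .
    moreover obtain v where v: "pres_eq thompson_relations (?r @ p) v" "length v \<le> 2 * k"
      using ball[of p "(i, b) # q"] w by auto
    moreover have "\<bar>shift_sum (?r @ p)\<bar> + \<bar>caret_sum (?r @ p)\<bar> \<le> int (length v)"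
      unfolding pres_eq_invariants(2,3)[OF v(1)] by (rule length_ge_sums)
    ultimately show False using sum_le i assms(2) by linarith
  qed
  \<comment> \<open>At the cut, \<open>a + c \<le> 0\<close>. The first piece starts at \<open>(a, c) = (1, -1)\<close> and contains a positive
    letter, the second ends at \<open>(2, 0)\<close> and contains a negative one.\<close>
  have "length p \<ge> 2 * k"
    using left_mark_lost_count[OF vals(3) before] length_eq_counts[of p] caret_sum_eq_counts[of p]
      vals(1,2) sum_le i by simp
  moreover have "length ((i, b) # q) \<ge> 2 * k"
    using left_mark_gained_count[OF before, of "(i, b) # q"] end_marks(1) end_sums
      length_eq_counts[of "(i, b) # q"] caret_sum_eq_counts[of "(i, b) # q"]
      sum_le i w by simp
  ultimately show ?thesis using w by simp
qed

section \<open>From words to the Cayley graph\<close>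

abbreviation cls :: "nat word \<Rightarrow> nat word set" where
  "cls \<equiv> word_class thompson_relations"

lemma thompson_F_mult [simp]: "cls u \<otimes>\<^bsub>thompson_F\<^esub> cls v = cls (u @ v)"
  by (simp add: thompson_F_def presented_group_mult)

lemma thompson_F_one: "\<one>\<^bsub>thompson_F\<^esub> = cls []"
  by (simp add: thompson_F_def presented_group_def)

lemma cls_closed [simp]: "cls w \<in> carrier thompson_F"
  by (simp add: thompson_F_def presented_group_def)

lemma symmetrized_gens:
  "symmetrized thompson_F (thompson_gen ` I) = (\<lambda>x. cls [x]) ` (I \<times> UNIV)"
proof -
  have "symmetrized thompson_F (thompson_gen ` I)
    = (\<lambda>i. cls [(i, True)]) ` I \<union> (\<lambda>i. cls [(i, False)]) ` I"
    by (simp add: symmetrized_def image_image thompson_F_inv_gen) (simp add: thompson_gen_def)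
  also have "\<dots> = (\<lambda>x. cls [x]) ` (I \<times> UNIV)"
    by (auto simp: image_iff) (metis (full_types))
  finally show ?thesis .
qed

lemma foldr_mult_letters:
  "foldr (mult thompson_F) (map (\<lambda>x. cls [x]) w) \<one>\<^bsub>thompson_F\<^esub> = cls w"
  by (induction w) (simp_all add: thompson_F_one)

lemma product_of_gens_iff:
  "(\<exists>ss. length ss = d \<and> set ss \<subseteq> symmetrized thompson_F (thompson_gen ` I) \<and>
      g = foldr (mult thompson_F) ss \<one>\<^bsub>thompson_F\<^esub>)
    \<longleftrightarrow> (\<exists>w. length w = d \<and> set w \<subseteq> I \<times> UNIV \<and> g = cls w)"
proof
  assume "\<exists>ss. length ss = d \<and> set ss \<subseteq> symmetrized thompson_F (thompson_gen ` I) \<and>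
      g = foldr (mult thompson_F) ss \<one>\<^bsub>thompson_F\<^esub>"
  then obtain ss where ss: "length ss = d" "set ss \<subseteq> (\<lambda>x. cls [x]) ` (I \<times> UNIV)"
    "g = foldr (mult thompson_F) ss \<one>\<^bsub>thompson_F\<^esub>"
    unfolding symmetrized_gens by blast
  from ss(2) have "ss \<in> map (\<lambda>x. cls [x]) ` lists (I \<times> UNIV)"
    unfolding lists_image[symmetric] by (simp add: in_lists_conv_set subset_eq)
  then obtain w where "set w \<subseteq> I \<times> UNIV" "ss = map (\<lambda>x. cls [x]) w"
    by (auto simp: in_lists_conv_set)
  then show "\<exists>w. length w = d \<and> set w \<subseteq> I \<times> UNIV \<and> g = cls w"
    using ss foldr_mult_letters by auto
next
  assume "\<exists>w. length w = d \<and> set w \<subseteq> I \<times> UNIV \<and> g = cls w"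
  then obtain w where w: "length w = d" "set w \<subseteq> I \<times> UNIV" "g = cls w" by blast
  show "\<exists>ss. length ss = d \<and> set ss \<subseteq> symmetrized thompson_F (thompson_gen ` I) \<and>
      g = foldr (mult thompson_F) ss \<one>\<^bsub>thompson_F\<^esub>"
    unfolding symmetrized_gens
    by (rule exI[of _ "map (\<lambda>x. cls [x]) w"]) (use w foldr_mult_letters in auto)
qed

lemma word_dist_eq:
  "word_dist thompson_F (thompson_gen ` I) g (cls w) =
    (LEAST d. \<exists>v. length v = d \<and> set v \<subseteq> I \<times> UNIV \<and> inv\<^bsub>thompson_F\<^esub> g \<otimes>\<^bsub>thompson_F\<^esub> cls w = cls v)"
  unfolding word_dist_def product_of_gens_iff ..

lemma word_ball_iff:
  assumes "set w \<subseteq> I \<times> UNIV"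
  shows "cls w \<in> word_ball thompson_F (thompson_gen ` I) m \<longleftrightarrow>
    (\<exists>v. pres_eq thompson_relations w v \<and> set v \<subseteq> I \<times> UNIV \<and> length v \<le> m)"
proof -
  interpret group thompson_F by (rule group_thompson_F)
  define P where "P d \<longleftrightarrow> (\<exists>v. length v = d \<and> set v \<subseteq> I \<times> UNIV \<and> cls w = cls v)" for d
  have dist: "word_dist thompson_F (thompson_gen ` I) \<one>\<^bsub>thompson_F\<^esub> (cls w) = (LEAST d. P d)"
    by (simp add: word_dist_eq P_def)
  have "P (LEAST d. P d)" by (rule LeastI[of P "length w"]) (use assms in \<open>auto simp: P_def\<close>)
  then have "(LEAST d. P d) \<le> m \<longleftrightarrow> (\<exists>d\<le>m. P d)" by (meson Least_le order_trans)
  then show ?thesis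
    unfolding word_ball_def using dist by (auto simp: P_def word_class_eq_iff)
qed

lemma awalk_word:
  defines "cayley I \<equiv> cayley_graph thompson_F (thompson_gen ` I)"
  assumes "pre_digraph.awalk (cayley I) (cls u) p h"
  shows "\<exists>w. length w = length p \<and> set w \<subseteq> I \<times> UNIV \<and> h = cls (u @ w) \<and>
    (\<forall>w1 w2. w = w1 @ w2 \<longrightarrow> cls (u @ w1) \<in> set (pre_digraph.awalk_verts (cayley I) (cls u) p))"
  using assms(2)
proof (induction p arbitrary: u)
  case Nil
  then have "h = cls u" by (simp add: pre_digraph.awalk_def pre_digraph.cas.simps)
  then show ?case by (intro exI[of _ "[]"]) (simp add: pre_digraph.awalk_verts.simps)
next
  case (Cons e p)
  have e: "e \<in> arcs (cayley I)" "tail (cayley I) e = cls u"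
    and rest: "set p \<subseteq> arcs (cayley I)" "pre_digraph.cas (cayley I) (head (cayley I) e) p h"
    using Cons.prems by (simp_all add: pre_digraph.awalk_def pre_digraph.cas.simps)
  obtain g s where gs: "e = (g, s)" by (cases e)
  have "s \<in> symmetrized thompson_F (thompson_gen ` I)" "g = cls u"
    using e by (simp_all add: gs cayley_def cayley_graph_def)
  then obtain x where x: "x \<in> I \<times> UNIV" and e': "e = (cls u, cls [x])"
    unfolding symmetrized_gens gs by blast
  have head: "head (cayley I) e = cls (u @ [x])" by (simp add: e' cayley_def cayley_graph_def)
  have verts: "pre_digraph.awalk_verts (cayley I) (cls u) (e # p)
      = cls u # pre_digraph.awalk_verts (cayley I) (cls (u @ [x])) p"
    by (simp add: pre_digraph.awalk_verts.simps e(2) head)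
  have "cls (u @ [x]) \<in> verts (cayley I)" by (simp add: cayley_def cayley_graph_def)
  then have "pre_digraph.awalk (cayley I) (cls (u @ [x])) p h"
    using rest unfolding head by (simp add: pre_digraph.awalk_def)
  from Cons.IH[OF this] obtain w where w: "length w = length p" "set w \<subseteq> I \<times> UNIV"
    "h = cls ((u @ [x]) @ w)"
    and wv: "\<forall>w1 w2. w = w1 @ w2 \<longrightarrow> cls ((u @ [x]) @ w1)
      \<in> set (pre_digraph.awalk_verts (cayley I) (cls (u @ [x])) p)"
    by (elim exE conjE)
  have "cls (u @ w1) \<in> set (pre_digraph.awalk_verts (cayley I) (cls u) (e # p))"
    if "x # w = w1 @ w2" for w1 w2
  proof (cases w1)
    case Nil
    then show ?thesis by (simp add: verts)
  next
    case (Cons y w1')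
    then have "y = x" "w = w1' @ w2" using that by simp_all
    then show ?thesis using wv Cons by (simp add: verts)
  qed
  then show ?case using w x by (intro exI[of _ "x # w"]) simp
qed

lemma not_minimally_almost_convex_gens:
  assumes I: "{0, 1, n} \<subseteq> I" "I \<subseteq> {..n}" and n: "n \<ge> 2"
  shows "\<not> minimally_almost_convex thompson_F (thompson_gen ` I)"
proof
  let ?X = "thompson_gen ` I"
  interpret group thompson_F by (rule group_thompson_F)
  assume "minimally_almost_convex thompson_F ?X"
  then obtain M where M: "\<And>m g h. \<lbrakk>m \<ge> M; g \<in> word_ball thompson_F ?X m; h \<in> word_ball thompson_F ?X m;
      word_dist thompson_F ?X g h = 2\<rbrakk> \<Longrightarrow>
      \<exists>p. pre_digraph.awalk (cayley_graph thompson_F ?X) g p h \<and>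
           set (pre_digraph.awalk_verts (cayley_graph thompson_F ?X) g p) \<subseteq> word_ball thompson_F ?X m \<and>
           length p \<le> 2 * m - 1"
    unfolding minimally_almost_convex_def by meson
  define k where "k = M + 2"
  have k: "k \<ge> 2" "2 * k \<ge> M" by (simp_all add: k_def)
  let ?r = "left_word k" and ?s = "[(n, True), (0, True)] :: nat word"
  have r: "set ?r \<subseteq> I \<times> UNIV" and s: "set ?s \<subseteq> I \<times> UNIV"
    using I by (auto simp: left_word_def)
  have "cls ?r \<in> word_ball thompson_F ?X (2 * k)"
    unfolding word_ball_iff[OF r] using r k
    by (intro exI[of _ ?r]) (auto simp: pres_eq.refl left_word_def)
  moreover have "cls (?r @ ?s) \<in> word_ball thompson_F ?X (2 * k)"
  proof -
    have rs: "set (?r @ ?s) \<subseteq> I \<times> UNIV" using r s by simp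
    show ?thesis unfolding word_ball_iff[OF rs]
      by (rule exI, intro conjI, rule short_word_for_neighbour[OF k(1) n]) (use I k in auto)
  qed
  \<comment> \<open>The distance is not smaller, as \<open>a + c\<close> is \<open>2\<close> on \<open>x\<^sub>n x\<^sub>0\<close> and changes by \<open>1\<close> with each letter.\<close>
  moreover have "word_dist thompson_F ?X (cls ?r) (cls (?r @ ?s)) = 2"
  proof -
    have "inv\<^bsub>thompson_F\<^esub> cls ?r \<otimes>\<^bsub>thompson_F\<^esub> cls (?r @ ?s) = cls ?s"
      unfolding thompson_F_mult[symmetric] by (simp add: m_assoc[symmetric] del: thompson_F_mult)
    moreover have "length v \<ge> 2" if "cls ?s = cls v" for v
    proof -
      have "shift_sum v + caret_sum v = 2"
        using pres_eq_invariants(2,3)[of ?s v] that n by (auto simp: word_class_eq_iff)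
      then show ?thesis using length_ge_sums[of v] by linarith
    qed
    ultimately show ?thesis
      unfolding word_dist_eq using s by (intro Least_equality) (auto intro!: exI[of _ ?s])
  qed
  ultimately obtain p where p: "pre_digraph.awalk (cayley_graph thompson_F ?X) (cls ?r) p (cls (?r @ ?s))"
    "set (pre_digraph.awalk_verts (cayley_graph thompson_F ?X) (cls ?r) p) \<subseteq> word_ball thompson_F ?X (2 * k)"
    "length p \<le> 2 * (2 * k) - 1"
    using M[OF k(2)] by blast
  obtain w where w: "length w = length p" "set w \<subseteq> I \<times> UNIV" "cls (?r @ ?s) = cls (?r @ w)"
    and wv: "\<forall>w1 w2. w = w1 @ w2 \<longrightarrow> cls (?r @ w1)
      \<in> set (pre_digraph.awalk_verts (cayley_graph thompson_F ?X) (cls ?r) p)"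
    using awalk_word[OF p(1)] by (elim exE conjE) (rule that)
  have "length w \<ge> 4 * k"
  proof (rule path_through_small_ball_is_long[OF k(1) n])
    show "fst ` set w \<subseteq> {..n}" using w(2) I(2) by auto
    show "pres_eq thompson_relations (?r @ w) (?r @ ?s)"
      using w(3) by (simp add: word_class_eq_iff pres_eq.sym)
    fix u v assume uv: "w = u @ v"
    then have "set (?r @ u) \<subseteq> I \<times> UNIV" using r w(2) by simp
    from word_ball_iff[OF this] wv uv p(2)
    show "\<exists>v. pres_eq thompson_relations (?r @ u) v \<and> length v \<le> 2 * k" by blast
  qed
  then show False using w(1) p(3) k by simp
qed

theorem theorem4p2:
  fixes j :: nat and i :: "nat \<Rightarrow> nat"
  assumes "j \<ge> 1"
    and "1 < i 1"
    and "strict_mono_on {1..j} i"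
  shows "\<not> minimally_almost_convex thompson_F
           ({thompson_gen 0, thompson_gen 1} \<union> (\<lambda>k. thompson_gen (i k)) ` {1..j})"
proof -
  have le: "i k \<le> i j" if "k \<in> {1..j}" for k
    using strict_mono_on_leD[OF assms(3), of k j] that by simp
  have j: "i j \<ge> 2" using le[of 1] assms(1,2) by simp
  have "\<not> minimally_almost_convex thompson_F (thompson_gen ` ({0, 1} \<union> i ` {1..j}))"
    by (rule not_minimally_almost_convex_gens[of "i j"]) (use assms(1) le j in auto)
  then show ?thesis by (simp add: image_Un image_image)
qed

end
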